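(* Let $\mathbb{F}_q$ be a finite field, let $\theta$ be an automorphism of $\mathbb{F}_q$, and let $\mathcal{C}$ be a linear code over $\mathbb{F}_q$ of length $n$. Suppose that the order $|\langle\theta\rangle|$ of $\theta$ divides $n$. Then $\mathcal{C}$ is a $\theta$-cyclic code if and only if its skew polynomial representation $\mathcal{C}(X)$ is a left ideal $(G)$ (generated by a single element $G$) of the ring $\mathbb{F}_q[X,\theta]/(X^n-1)$.
   Context: A linear code of length $n$ over $\mathbb{F}_q$ is an $\mathbb{F}_q$-vector subspace of $\mathbb{F}_q^n$. A linear code $\mathcal{C}\subset\mathbb{F}_q^n$ is called $\theta$-cyclic if $(a_0,a_1,\ldots,a_{n-1})\in\mathcal{C}$ implies $(\theta(a_{n-1}),\theta(a_0),\theta(a_1),\ldots,\theta(a_{n-2}))\in\mathcal{C}$. $\mathbb{F}_q[X,\theta]$ is the skew polynomial ring: its elements are formal polynomials $\sum_i a_iX^i$ with coefficients $a_i\in\mathbb{F}_q$ written on the left, addition is the usual one, and multiplication is determined by $Xa=\theta(a)X$ for $a\in\mathbb{F}_q$, extended by associativity and distributivity. When the order of $\theta$ divides $n$, the element $X^n-1$ is central, so it generates a two-sided ideal $(X^n-1)$ and $\mathbb{F}_q[X,\theta]/(X^n-1)$ is a ring; each of its elements is represented uniquely by a skew polynomial of degree $<n$ (its remainder under right division by $X^n-1$), and the image of $X$ is still denoted $X$. The skew polynomial representation $\mathcal{C}(X)$ of $\mathcal{C}$ is the set of all elements $a(X)=a_{n-1}X^{n-1}+\cdots+a_1X+a_0\in\mathbb{F}_q[X,\theta]/(X^n-1)$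 with $(a_0,a_1,\ldots,a_{n-1})\in\mathcal{C}$. *)

theory Defs
  imports
    "Jordan_Normal_Form.VS_Connect"
    "HOL-Algebra.QuotRing"
    "HOL-Algebra.Generated_Groups"
    "HOL-Algebra.Bij"
begin

section \<open>Skew polynomials\<close>

text \<open>
  Skew polynomials have the same underlying additive group as ordinary polynomials, with
  coefficients written on the left. The rule \<open>X a = \<theta>(a) X\<close> gives
  \<open>(a X^i) (b X^j) = a (\<theta> ^^ i)(b) X^(i + j)\<close>, which is extended biadditively.
\<close>

definition skew_mult :: "('a::field \<Rightarrow> 'a) \<Rightarrow> 'a poly \<Rightarrow> 'a poly \<Rightarrow> 'a poly" where
  "skew_mult \<theta> p q =
     (\<Sum>i\<le>degree p. \<Sum>j\<le>degree q. monom (coeff p i * (\<theta> ^^ i) (coeff q j)) (i + j))"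

definition skew_poly_ring :: "('a::field \<Rightarrow> 'a) \<Rightarrow> 'a poly ring" where
  "skew_poly_ring \<theta> =
     \<lparr>carrier = UNIV, mult = skew_mult \<theta>, one = 1, zero = 0, add = (+)\<rparr>"

definition skew_modulus :: "('a::field \<Rightarrow> 'a) \<Rightarrow> nat \<Rightarrow> 'a poly set" where
  "skew_modulus \<theta> n = Idl\<^bsub>skew_poly_ring \<theta>\<^esub> {monom 1 n - 1}"

definition skew_quotient :: "('a::field \<Rightarrow> 'a) \<Rightarrow> nat \<Rightarrow> 'a poly set ring" where
  "skew_quotient \<theta> n = skew_poly_ring \<theta> Quot skew_modulus \<theta> n"


section \<open>Left ideals\<close>

text \<open>One-sided counterparts of \<^locale>\<open>ideal\<close>, \<^const>\<open>genideal\<close> and \<^locale>\<open>principalideal\<close>.\<close>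

locale left_ideal = additive_subgroup I R + ring R for I and R (structure) +
  assumes I_l_closed: "\<lbrakk>a \<in> I; x \<in> carrier R\<rbrakk> \<Longrightarrow> x \<otimes> a \<in> I"

definition gen_left_ideal :: "('a, 'b) ring_scheme \<Rightarrow> 'a set \<Rightarrow> 'a set" where
  "gen_left_ideal R S = \<Inter>{I. left_ideal I R \<and> S \<subseteq> I}"

locale principal_left_ideal = left_ideal +
  assumes generate: "\<exists>g \<in> carrier R. I = gen_left_ideal R {g}"


section \<open>Codes\<close>

definition linear_code :: "nat \<Rightarrow> 'a::field vec set \<Rightarrow> bool" where
  "linear_code n C \<longleftrightarrow> VectorSpace.subspace class_ring C (module_vec TYPE('a) n)"

definition skew_shift :: "('a \<Rightarrow> 'a) \<Rightarrow> nat \<Rightarrow> 'a vec \<Rightarrow> 'a vec" where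
  "skew_shift \<theta> n a = vec n (\<lambda>i. \<theta> (if i = 0 then a $ (n - 1) else a $ (i - 1)))"

definition skew_cyclic :: "('a \<Rightarrow> 'a) \<Rightarrow> nat \<Rightarrow> 'a vec set \<Rightarrow> bool" where
  "skew_cyclic \<theta> n C \<longleftrightarrow> (\<forall>a\<in>C. skew_shift \<theta> n a \<in> C)"

definition vec_to_poly :: "nat \<Rightarrow> 'a::field vec \<Rightarrow> 'a poly" where
  "vec_to_poly n a = (\<Sum>i<n. monom (a $ i) i)"

definition skew_poly_rep :: "('a::field \<Rightarrow> 'a) \<Rightarrow> nat \<Rightarrow> 'a vec set \<Rightarrow> 'a poly set set" where
  "skew_poly_rep \<theta> n C =
     (\<lambda>a. skew_modulus \<theta> n +>\<^bsub>skew_poly_ring \<theta>\<^esub> vec_to_poly n a) ` C"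


section \<open>Basic facts on skew polynomials\<close>

context
  fixes \<theta> :: "'a::field \<Rightarrow> 'a"
  assumes hom: "\<theta> \<in> Ring.ring_hom class_ring class_ring"
begin

lemma theta_simps:
  "\<theta> (a + b) = \<theta> a + \<theta> b" "\<theta> (a * b) = \<theta> a * \<theta> b" "\<theta> 1 = 1" "\<theta> 0 = 0"
proof -
  show add: "\<theta> (a + b) = \<theta> a + \<theta> b" for a b
    using ring_hom_add[OF hom, of a b] by simp
  show "\<theta> (a * b) = \<theta> a * \<theta> b" using ring_hom_mult[OF hom, of a b] by simp
  show "\<theta> 1 = 1" using ring_hom_one[OF hom] by simp
  show "\<theta> 0 = 0" using add[of 0 0] by (metis add.right_neutral add_left_cancel)
qed

lemma theta_pow_simps:
  "(\<theta> ^^ i) (a + b) = (\<theta> ^^ i) a + (\<theta> ^^ i) b"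
  "(\<theta> ^^ i) (a * b) = (\<theta> ^^ i) a * (\<theta> ^^ i) b"
  "(\<theta> ^^ i) 1 = 1" "(\<theta> ^^ i) 0 = 0"
  by (induction i) (simp_all add: theta_simps)

lemma skew_mult_bounded:
  assumes "degree p \<le> N" "degree q \<le> M"
  shows "skew_mult \<theta> p q =
    (\<Sum>i\<le>N. \<Sum>j\<le>M. monom (coeff p i * (\<theta> ^^ i) (coeff q j)) (i + j))"
proof -
  have "(\<Sum>i\<le>N. \<Sum>j\<le>M. monom (coeff p i * (\<theta> ^^ i) (coeff q j)) (i + j))
      = (\<Sum>i\<le>N. \<Sum>j\<le>degree q. monom (coeff p i * (\<theta> ^^ i) (coeff q j)) (i + j))"
    using assms
    by (intro sum.cong refl sum.mono_neutral_right)
       (auto simp: coeff_eq_0 theta_pow_simps not_le)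
  also have "\<dots> = skew_mult \<theta> p q"
    unfolding skew_mult_def using assms
    by (intro sum.mono_neutral_right) (auto simp: coeff_eq_0 not_le)
  finally show ?thesis by simp
qed

lemma skew_mult_add_left: "skew_mult \<theta> (p + p') q = skew_mult \<theta> p q + skew_mult \<theta> p' q"
proof -
  define N where "N = max (degree p) (degree p')"
  have N: "degree p \<le> N" "degree p' \<le> N" "degree (p + p') \<le> N"
    using degree_add_le_max[of p p'] by (auto simp: N_def)
  show ?thesis
    by (simp add: skew_mult_bounded[OF N(1) order_refl] skew_mult_bounded[OF N(2) order_refl]
        skew_mult_bounded[OF N(3) order_refl] algebra_simps sum.distrib flip: add_monom)
qed

lemma skew_mult_add_right: "skew_mult \<theta> p (q + q') = skew_mult \<theta> p q + skew_mult \<theta> p q'"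
proof -
  define N where "N = max (degree q) (degree q')"
  have N: "degree q \<le> N" "degree q' \<le> N" "degree (q + q') \<le> N"
    using degree_add_le_max[of q q'] by (auto simp: N_def)
  show ?thesis
    by (simp add: skew_mult_bounded[OF order_refl N(1)] skew_mult_bounded[OF order_refl N(2)]
        skew_mult_bounded[OF order_refl N(3)] algebra_simps sum.distrib theta_pow_simps
        flip: add_monom)
qed

lemma skew_mult_zero [simp]: "skew_mult \<theta> 0 q = 0" "skew_mult \<theta> p 0 = 0"
  by (simp_all add: skew_mult_def theta_pow_simps)

lemma skew_mult_monom: "skew_mult \<theta> (monom a i) (monom b j) = monom (a * (\<theta> ^^ i) b) (i + j)"
proof -
  have "skew_mult \<theta> (monom a i) (monom b j) =
      (\<Sum>k\<le>i. \<Sum>l\<le>j. monom (coeff (monom a i) k * (\<theta> ^^ k) (coeff (monom b j) l)) (k + l))"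
    by (rule skew_mult_bounded) (simp_all add: degree_monom_le)
  also have "\<dots> = (\<Sum>k\<le>i. \<Sum>l\<le>j. if l = j then if k = i then monom (a * (\<theta> ^^ i) b) (i + j) else 0 else 0)"
    by (intro sum.cong refl) (auto simp: theta_pow_simps)
  finally show ?thesis by (simp add: sum.delta)
qed

lemma X_skew_mult: "skew_mult \<theta> (monom 1 1) (monom a 0) = skew_mult \<theta> (monom (\<theta> a) 0) (monom 1 1)"
  by (simp add: skew_mult_monom)

lemma poly_additive_induct:
  fixes p :: "'a poly"
  assumes "P 0" "\<And>p q. P p \<Longrightarrow> P q \<Longrightarrow> P (p + q)" "\<And>a i. P (monom a i)"
  shows "P p"
proof -
  have "P (\<Sum>i\<in>A. monom (coeff p i) i)" if "finite A" for A
    using that by induction (auto intro: assms)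
  from this[of "{..degree p}"] show ?thesis by (simp add: poly_as_sum_of_monoms)
qed

lemma skew_mult_assoc:
  "skew_mult \<theta> (skew_mult \<theta> p q) r = skew_mult \<theta> p (skew_mult \<theta> q r)"
proof (induction p rule: poly_additive_induct)
  case (3 a i)
  show ?case
  proof (induction q rule: poly_additive_induct)
    case (3 b j)
    show ?case
      by (induction r rule: poly_additive_induct)
         (simp_all add: skew_mult_add_right skew_mult_monom theta_pow_simps funpow_add ac_simps)
  qed (simp_all add: skew_mult_add_left skew_mult_add_right)
qed (simp_all add: skew_mult_add_left)

lemma skew_mult_one [simp]: "skew_mult \<theta> 1 p = p" "skew_mult \<theta> p 1 = p"
proof -
  have "skew_mult \<theta> 1 (monom a i) = monom a i" for a i
    using skew_mult_monom[of 1 0 a i] by simp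
  then show "skew_mult \<theta> 1 p = p"
    by (induction p rule: poly_additive_induct) (simp_all add: skew_mult_add_right)
  have "skew_mult \<theta> (monom a i) 1 = monom a i" for a i
    using skew_mult_monom[of a i 1 0] by (simp add: theta_pow_simps)
  then show "skew_mult \<theta> p 1 = p"
    by (induction p rule: poly_additive_induct) (simp_all add: skew_mult_add_left)
qed

lemma ring_skew_poly_ring: "ring (skew_poly_ring \<theta>)"
proof (rule ringI)
  show "abelian_group (skew_poly_ring \<theta>)"
    by (rule abelian_groupI)
       (auto simp: skew_poly_ring_def ac_simps intro: exI[of _ "- x" for x])
  show "Group.monoid (skew_poly_ring \<theta>)"
    by (rule monoidI) (auto simp: skew_poly_ring_def skew_mult_assoc)
qed (auto simp: skew_poly_ring_def skew_mult_add_left skew_mult_add_right)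

end

end

theory Submission
  imports "HOL-Algebra.Multiplicative_Group" Defs
begin

text \<open>
  Write \<open>R\<close> for the skew polynomial ring and \<open>\<star>\<close> for its product. Since the order of \<open>\<theta>\<close> divides
  \<open>n\<close>, the power \<open>\<theta> ^^ n\<close> is the identity, so \<open>X^n - 1\<close> is central; moreover \<open>\<theta>\<close> fixes \<open>0\<close> and
  \<open>1\<close>, so right multiplication by \<open>X^n - 1\<close> in \<open>R\<close> is the ordinary product of polynomials. Hence
  the two-sided ideal \<open>(X^n - 1)\<close> consists of the ordinary multiples of \<open>X^n - 1\<close>
  (\<open>skew_modulus_eq_dvd\<close>), and a residue class has at most one representative of degree
  below \<open>n\<close>.

  The bridge between codes and ideals is the identity
  \<open>X \<star> a(X) = (shift a)(X) + \<theta>(a_(n-1)) (X^n - 1)\<close>, where \<open>shift\<close> is the \<open>\<theta>\<close>-twisted cyclic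
  shift: in the quotient, shifting a word is multiplying by \<open>X\<close>
  (\<open>X_skew_mult_vec_to_poly\<close>). If \<open>\<C>(X)\<close> is a left ideal, it is closed under multiplication by
  \<open>X\<close>, and uniqueness of representatives gives that \<open>\<C>\<close> is closed under the shift. Conversely,
  if \<open>\<C>\<close> is closed under the shift, then its preimage in \<open>R\<close> is closed under addition, under
  scalars and under \<open>X\<close>, hence is a left ideal of \<open>R\<close> (\<open>left_ideal_code_preimage\<close>). Right division
  with remainder makes every left ideal of \<open>R\<close> principal (\<open>left_ideal_skew_poly_principal\<close>), and
  surjective ring homomorphisms preserve this (\<open>principal_left_ideal_image\<close>).

  The argument covers \<open>n = 0\<close> as well: there \<open>X^n - 1 = 0\<close>, the quotient is \<open>R\<close> itself, and the only
  code is the zero code.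
\<close>

section \<open>Principal left ideals\<close>

lemma left_idealI:
  fixes R (structure)
  assumes "ring R" and sub: "I \<subseteq> carrier R" and zero: "\<zero> \<in> I"
    and add: "\<And>a b. a \<in> I \<Longrightarrow> b \<in> I \<Longrightarrow> a \<oplus> b \<in> I"
    and l_closed: "\<And>a x. a \<in> I \<Longrightarrow> x \<in> carrier R \<Longrightarrow> x \<otimes> a \<in> I"
  shows "left_ideal I R"
proof -
  interpret ring R by fact
  \<comment> \<open>Closure under negation is left multiplication by \<open>-1\<close>.\<close>
  have "\<ominus> a \<in> I" if "a \<in> I" for a
  proof -
    have "\<ominus> a = \<ominus> \<one> \<otimes> a" using that sub by (auto simp: l_minus)
    then show ?thesis using l_closed[OF that, of "\<ominus> \<one>"] by simp
  qed
  then have "subgroup I (add_monoid R)"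
    using sub zero add by (intro add.subgroupI) (auto simp: a_inv_def)
  then show ?thesis
    by (intro left_ideal.intro additive_subgroupI left_ideal_axioms.intro l_closed) (use assms in auto)
qed

lemma left_ideal_right_multiples:
  fixes R (structure)
  assumes "ring R" and g: "g \<in> carrier R"
  shows "left_ideal ((\<lambda>x. x \<otimes> g) ` carrier R) R" (is "left_ideal ?I R")
proof -
  interpret ring R by fact
  show ?thesis
  proof (rule left_idealI[OF \<open>ring R\<close>])
    show "\<zero> \<in> ?I" using g by (auto intro!: image_eqI[where x = \<zero>])
    show "a \<oplus> b \<in> ?I" if "a \<in> ?I" "b \<in> ?I" for a b
      using that g by (auto simp: l_distr[symmetric])
    show "x \<otimes> a \<in> ?I" if "a \<in> ?I" "x \<in> carrier R" for a x
      using that g by (auto simp: m_assoc[symmetric])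
  qed (use g in auto)
qed

lemma gen_left_ideal_singleton:
  fixes R (structure)
  assumes "ring R" and g: "g \<in> carrier R"
  shows "gen_left_ideal R {g} = (\<lambda>x. x \<otimes> g) ` carrier R" (is "_ = ?I")
proof
  interpret ring R by fact
  have "g \<in> ?I" using g by (auto intro!: image_eqI[where x = \<one>])
  with left_ideal_right_multiples[OF assms] show "gen_left_ideal R {g} \<subseteq> ?I"
    by (auto simp: gen_left_ideal_def)
  show "?I \<subseteq> gen_left_ideal R {g}"
    by (auto simp: gen_left_ideal_def intro: left_ideal.I_l_closed)
qed

lemma principal_left_idealI:
  fixes R (structure)
  assumes "ring R" and "g \<in> carrier R" and I: "I = (\<lambda>x. x \<otimes> g) ` carrier R"
  shows "principal_left_ideal I R"
  using left_ideal_right_multiples[OF assms(1,2)] gen_left_ideal_singleton[OF assms(1,2)] assms(2)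
  by (intro principal_left_ideal.intro principal_left_ideal_axioms.intro) (auto simp: I)

lemma principal_left_ideal_image:
  assumes h: "ring_hom_ring R S h" and surj: "h ` carrier R = carrier S"
    and I: "principal_left_ideal I R"
  shows "principal_left_ideal (h ` I) S"
proof -
  interpret h: ring_hom_ring R S h by fact
  obtain g where g: "g \<in> carrier R" "I = gen_left_ideal R {g}"
    using principal_left_ideal.generate[OF I] by auto
  have "h ` I = (\<lambda>x. h x \<otimes>\<^bsub>S\<^esub> h g) ` carrier R"
    using g gen_left_ideal_singleton[OF h.R.ring_axioms g(1)] by (simp add: image_image)
  also have "\<dots> = (\<lambda>y. y \<otimes>\<^bsub>S\<^esub> h g) ` carrier S"
    by (simp flip: surj add: image_image)
  finally show ?thesis
    using g h.S.ring_axioms by (intro principal_left_idealI[where g = "h g"]) auto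
qed


section \<open>Left ideals of the skew polynomial ring\<close>

context
  fixes \<theta> :: "'a::field \<Rightarrow> 'a"
  assumes hom: "\<theta> \<in> Ring.ring_hom class_ring class_ring"
begin

lemmas skew_simps =
  theta_simps[OF hom] theta_pow_simps[OF hom] skew_mult_zero[OF hom] skew_mult_one[OF hom]
  skew_mult_monom[OF hom] skew_mult_add_left[OF hom] skew_mult_add_right[OF hom]

lemma skew_poly_ring_simps:
  "carrier (skew_poly_ring \<theta>) = UNIV" "mult (skew_poly_ring \<theta>) = skew_mult \<theta>"
  "one (skew_poly_ring \<theta>) = 1" "zero (skew_poly_ring \<theta>) = 0" "add (skew_poly_ring \<theta>) = (+)"
  by (simp_all add: skew_poly_ring_def)

lemma skew_mult_diff_left: "skew_mult \<theta> (p - q) r = skew_mult \<theta> p r - skew_mult \<theta> q r"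
  using skew_mult_add_left[OF hom, of "p - q" q r] by simp

lemma skew_mult_diff_right: "skew_mult \<theta> p (q - r) = skew_mult \<theta> p q - skew_mult \<theta> p r"
  using skew_mult_add_right[OF hom, of p "q - r" r] by simp

lemma theta_pow_eq_0_iff: "(\<theta> ^^ i) a = 0 \<longleftrightarrow> a = 0"
proof
  assume *: "(\<theta> ^^ i) a = 0"
  show "a = 0"
  proof (rule ccontr)
    assume "a \<noteq> 0"
    then have "(\<theta> ^^ i) 1 = (\<theta> ^^ i) a * (\<theta> ^^ i) (inverse a)"
      by (simp flip: theta_pow_simps(2)[OF hom])
    with * show False by (simp add: skew_simps)
  qed
qed (simp add: skew_simps)

lemma skew_mult_monom_left: "skew_mult \<theta> (monom a i) p = monom a i * map_poly (\<theta> ^^ i) p"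
proof (induction p rule: poly_additive_induct[OF hom])
  case (2 p q)
  have "map_poly (\<theta> ^^ i) (p + q) = map_poly (\<theta> ^^ i) p + map_poly (\<theta> ^^ i) q"
    by (rule poly_eqI) (simp add: coeff_map_poly skew_simps)
  with 2 show ?case by (simp add: skew_simps algebra_simps)
qed (simp_all add: skew_simps map_poly_monom mult_monom)

text \<open>
  Right division by \<open>g\<close>: the leading term of \<open>p\<close> is cancelled by \<open>c X^k \<star> g\<close>, whose leading
  coefficient is \<open>c * (\<theta> ^^ k) (lead_coeff g)\<close>. Here \<open>k\<close> is the difference of the degrees, and \<open>c\<close>
  exists because \<open>\<theta> ^^ k\<close>, a homomorphism of fields, does not kill \<open>lead_coeff g\<close>.
\<close>

lemma skew_right_division:
  assumes "g \<noteq> 0"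
  shows "\<exists>q. p - skew_mult \<theta> q g = 0 \<or> degree (p - skew_mult \<theta> q g) < degree g"
proof (induction "degree p" arbitrary: p rule: less_induct)
  case less
  consider "degree p < degree g" | "p = 0" | "degree g \<le> degree p" "p \<noteq> 0" by linarith
  then show ?case
  proof cases
    case 3
    define k where "k = degree p - degree g"
    define c where "c = lead_coeff p / (\<theta> ^^ k) (lead_coeff g)"
    define r where "r = p - skew_mult \<theta> (monom c k) g"
    have deg: "degree (map_poly (\<theta> ^^ k) g) = degree g"
      by (rule degree_map_poly) (simp add: theta_pow_eq_0_iff)
    have "(\<theta> ^^ k) (lead_coeff g) \<noteq> 0" using assms by (simp add: theta_pow_eq_0_iff)
    then have "coeff r (degree p) = 0"
      using 3 by (simp add: r_def skew_mult_monom_left coeff_monom_mult k_def[symmetric] c_def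
          coeff_map_poly skew_simps) (simp add: k_def)
    moreover have "degree r \<le> degree p"
    proof -
      have "degree (monom c k * map_poly (\<theta> ^^ k) g) \<le> k + degree g"
        by (rule order_trans[OF degree_mult_le]) (simp add: deg degree_monom_le)
      then show ?thesis
        using 3 by (auto simp: r_def skew_mult_monom_left k_def intro!: degree_diff_le)
    qed
    ultimately have r: "r = 0 \<or> degree r < degree p"
      by (metis le_neq_implies_less leading_coeff_0_iff)
    show ?thesis
    proof (cases "r = 0")
      case False
      then obtain q where "r - skew_mult \<theta> q g = 0 \<or> degree (r - skew_mult \<theta> q g) < degree g"
        using less r by blast
      moreover have "r - skew_mult \<theta> q g = p - skew_mult \<theta> (monom c k + q) g"
        by (simp add: r_def skew_simps)
      ultimately show ?thesis by metis
    qed (use r_def in auto)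
  qed (auto intro!: exI[of _ 0] simp: skew_simps)
qed

text \<open>
  In a nonzero left ideal, a nonzero element of least degree generates: the remainders of its right
  divisions lie in the ideal and have smaller degree, so they are zero.
\<close>

lemma left_ideal_skew_poly_principal:
  assumes L: "left_ideal L (skew_poly_ring \<theta>)"
  shows "principal_left_ideal L (skew_poly_ring \<theta>)"
proof -
  interpret left_ideal L "skew_poly_ring \<theta>" by fact
  note l_closed = I_l_closed[simplified skew_poly_ring_simps, OF _ UNIV_I]
  have diff: "p - q \<in> L" if "p \<in> L" "q \<in> L" for p q
  proof -
    have "p + skew_mult \<theta> (- 1) q \<in> L"
      using additive_subgroup.a_closed[OF is_additive_subgroup \<open>p \<in> L\<close> l_closed[OF \<open>q \<in> L\<close>]]
      by (simp add: skew_poly_ring_simps)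
    moreover have "skew_mult \<theta> (- 1) q = - q"
      using skew_mult_diff_left[of 0 1 q] by (simp add: skew_simps)
    ultimately show ?thesis by simp
  qed
  obtain g where g: "g \<in> L" "\<And>p. p \<in> L \<Longrightarrow> \<exists>q. p = skew_mult \<theta> q g"
  proof (cases "L \<subseteq> {0}")
    case True
    have "0 \<in> L"
      using additive_subgroup.zero_closed[OF is_additive_subgroup] by (simp add: skew_poly_ring_simps)
    with True show ?thesis by (intro that[of 0]) (auto simp: skew_simps)
  next
    case False
    then have "\<exists>g. (g \<in> L \<and> g \<noteq> 0) \<and> (\<forall>p. p \<in> L \<and> p \<noteq> 0 \<longrightarrow> degree g \<le> degree p)"
      by (intro ex_has_least_nat[where P = "\<lambda>g. g \<in> L \<and> g \<noteq> 0" and k = "SOME g. g \<in> L \<and> g \<noteq> 0"])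
         (metis (mono_tags, lifting) singletonI someI subsetI)
    then obtain g where g: "g \<in> L" "g \<noteq> 0" "\<And>p. p \<in> L \<Longrightarrow> p \<noteq> 0 \<Longrightarrow> degree g \<le> degree p"
      by auto
    show ?thesis
    proof (rule that[OF g(1)])
      fix p assume "p \<in> L"
      obtain q where q: "p - skew_mult \<theta> q g = 0 \<or> degree (p - skew_mult \<theta> q g) < degree g"
        using skew_right_division[OF g(2)] by blast
      have "p - skew_mult \<theta> q g \<in> L" using \<open>p \<in> L\<close> g(1) diff l_closed by blast
      with q g(3) have "p - skew_mult \<theta> q g = 0" by (meson not_le)
      then show "\<exists>q. p = skew_mult \<theta> q g" by auto
    qed
  qed
  show ?thesis
    using g l_closed ring_skew_poly_ring[OF hom]
    by (intro principal_left_idealI[where g = g]) (auto simp: skew_poly_ring_simps)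
qed


section \<open>The two-sided ideal generated by X^n - 1\<close>

lemma skew_mult_modulus_right: "skew_mult \<theta> p (monom 1 n - 1) = p * (monom 1 n - 1)"
  by (induction p rule: poly_additive_induct[OF hom])
     (simp_all add: skew_mult_diff_right skew_simps algebra_simps mult_monom)

lemma modulus_central:
  assumes "\<theta> ^^ n = id"
  shows "skew_mult \<theta> (monom 1 n - 1) p = skew_mult \<theta> p (monom 1 n - 1)"
  by (induction p rule: poly_additive_induct[OF hom])
     (simp_all add: skew_mult_diff_left skew_mult_diff_right skew_simps assms add.commute)

lemma ideal_skew_modulus: "ideal (skew_modulus \<theta> n) (skew_poly_ring \<theta>)"
  unfolding skew_modulus_def
  by (rule ring.genideal_ideal[OF ring_skew_poly_ring[OF hom]]) (simp add: skew_poly_ring_simps)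

text \<open>
  The left multiples of \<open>X^n - 1\<close> already form a two-sided ideal because \<open>X^n - 1\<close> is central. The
  divisibility is that of the commutative ring of ordinary polynomials, which makes its degree
  arguments available for residue classes.
\<close>

lemma skew_modulus_eq_dvd:
  assumes "\<theta> ^^ n = id"
  shows "skew_modulus \<theta> n = {f. (monom 1 n - 1) dvd f}" (is "_ = ?D")
proof
  interpret R: ring "skew_poly_ring \<theta>" by (rule ring_skew_poly_ring[OF hom])
  have D: "?D = range (\<lambda>p. skew_mult \<theta> p (monom 1 n - 1))"
    by (auto simp: skew_mult_modulus_right dvd_def mult.commute)
  have "left_ideal ?D (skew_poly_ring \<theta>)"
    by (rule principal_left_ideal.axioms, rule principal_left_idealI[where g = "monom 1 n - 1"])
       (simp_all add: D skew_poly_ring_simps R.ring_axioms)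
  moreover have "skew_mult \<theta> a x \<in> ?D" if "a \<in> ?D" for a x
    using that unfolding D by (auto simp: skew_mult_assoc[OF hom] modulus_central[OF assms])
       (simp flip: skew_mult_assoc[OF hom])
  ultimately have "ideal ?D (skew_poly_ring \<theta>)"
    unfolding left_ideal_def left_ideal_axioms_def ideal_def ideal_axioms_def
    by (simp add: skew_poly_ring_simps)
  then show "skew_modulus \<theta> n \<subseteq> ?D"
    unfolding skew_modulus_def by (rule R.genideal_minimal) simp
  interpret I: ideal "skew_modulus \<theta> n" "skew_poly_ring \<theta>" by (rule ideal_skew_modulus)
  have "monom 1 n - 1 \<in> skew_modulus \<theta> n"
    unfolding skew_modulus_def by (rule R.genideal_self') (simp add: skew_poly_ring_simps)
  then show "?D \<subseteq> skew_modulus \<theta> n"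
    using I.I_l_closed unfolding D by (auto simp: skew_poly_ring_simps)
qed

text \<open>This is what makes the representative of degree below \<open>n\<close> of a residue class unique.\<close>

lemma modulus_dvd_imp_eq_0:
  fixes f :: "'a poly"
  assumes dvd: "(monom 1 n - 1) dvd f" and f: "\<And>i. i \<ge> n \<Longrightarrow> coeff f i = 0"
  shows "f = 0"
proof (rule ccontr)
  assume "f \<noteq> 0"
  then have less: "degree f < n" using f by (metis leading_coeff_0_iff not_le)
  then have "coeff (monom 1 n - 1 :: 'a poly) n = 1" by (simp add: coeff_1)
  then have "n \<le> degree (monom 1 n - 1 :: 'a poly)" by (intro le_degree) simp
  also have "\<dots> \<le> degree f" using dvd \<open>f \<noteq> 0\<close> by (rule dvd_imp_degree_le)
  finally show False using less by simp
qed

lemma skew_class_eq_iff: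
  assumes "\<theta> ^^ n = id"
  shows "skew_modulus \<theta> n +>\<^bsub>skew_poly_ring \<theta>\<^esub> p = skew_modulus \<theta> n +>\<^bsub>skew_poly_ring \<theta>\<^esub> q
     \<longleftrightarrow> (monom 1 n - 1) dvd (p - q)" (is "?l \<longleftrightarrow> ?r")
proof -
  have cls: "skew_modulus \<theta> n +>\<^bsub>skew_poly_ring \<theta>\<^esub> p = {f. (monom 1 n - 1) dvd (f - p)}" for p
  proof (rule Set.set_eqI)
    fix f
    have "f = d + p \<longleftrightarrow> d = f - p" for d by (auto simp: algebra_simps)
    then show "f \<in> skew_modulus \<theta> n +>\<^bsub>skew_poly_ring \<theta>\<^esub> p
        \<longleftrightarrow> f \<in> {f. (monom 1 n - 1) dvd (f - p)}"
      unfolding a_r_coset_def' skew_modulus_eq_dvd[OF assms] skew_poly_ring_simps by simp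
  qed
  show ?thesis
  proof
    assume ?l
    moreover have "p \<in> {f. (monom 1 n - 1) dvd (f - p)}" by simp
    ultimately show ?r unfolding cls by blast
  next
    assume r: ?r
    have "(monom 1 n - 1) dvd (f - p) \<longleftrightarrow> (monom 1 n - 1) dvd (f - q)" for f
      using dvd_add_left_iff[OF r, of "f - p"] by simp
    then show ?l unfolding cls by simp
  qed
qed

lemma skew_class_hom:
  "ring_hom_ring (skew_poly_ring \<theta>) (skew_quotient \<theta> n)
     (\<lambda>p. skew_modulus \<theta> n +>\<^bsub>skew_poly_ring \<theta>\<^esub> p)"
  unfolding skew_quotient_def using ideal_skew_modulus by (rule ideal.rcos_ring_hom_ring)

lemma skew_class_surj:
  "(\<lambda>p. skew_modulus \<theta> n +>\<^bsub>skew_poly_ring \<theta>\<^esub> p) ` carrier (skew_poly_ring \<theta>)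
     = carrier (skew_quotient \<theta> n)"
  by (auto simp: skew_quotient_def FactRing_def A_RCOSETS_def' skew_poly_ring_simps)


section \<open>Codes as sets of residue classes\<close>

lemma coeff_vec_to_poly: "coeff (vec_to_poly n a) i = (if i < n then a $ i else 0)"
  by (simp add: vec_to_poly_def coeff_sum sum.delta')

lemma vec_to_poly_inj:
  assumes "a \<in> carrier_vec n" "b \<in> carrier_vec n" "vec_to_poly n a = vec_to_poly n b"
  shows "a = b"
proof (rule eq_vecI)
  fix i assume "i < dim_vec b"
  then show "a $ i = b $ i"
    using assms coeff_vec_to_poly[of n a i] coeff_vec_to_poly[of n b i] by simp
qed (use assms in simp)

text \<open>
  Multiplication by \<open>X\<close> moves the last entry to degree \<open>n\<close>; reducing it modulo \<open>X^n - 1\<close> puts it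
  back in degree \<open>0\<close>. For \<open>n = 0\<close> both sides vanish.
\<close>

lemma X_skew_mult_vec_to_poly:
  "skew_mult \<theta> (monom 1 1) (vec_to_poly n a)
     = vec_to_poly n (skew_shift \<theta> n a) + Polynomial.smult (\<theta> (a $ (n - 1))) (monom 1 n - 1)"
proof (rule poly_eqI)
  fix i
  show "coeff (skew_mult \<theta> (monom 1 1) (vec_to_poly n a)) i =
    coeff (vec_to_poly n (skew_shift \<theta> n a) + Polynomial.smult (\<theta> (a $ (n - 1))) (monom 1 n - 1)) i"
    by (cases "n = 0"; cases i)
       (auto simp: skew_mult_monom_left coeff_monom_mult coeff_map_poly skew_simps
          coeff_vec_to_poly skew_shift_def coeff_1)
qed

lemma vec_to_poly_zero: "vec_to_poly n (0\<^sub>v n) = 0"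
  by (rule poly_eqI) (simp add: coeff_vec_to_poly)

lemma vec_to_poly_add:
  assumes "b \<in> carrier_vec n"
  shows "vec_to_poly n (a + b) = vec_to_poly n a + vec_to_poly n b"
  using assms by (intro poly_eqI) (simp add: coeff_vec_to_poly)

lemma vec_to_poly_smult:
  assumes "a \<in> carrier_vec n"
  shows "vec_to_poly n (c \<cdot>\<^sub>v a) = Polynomial.smult c (vec_to_poly n a)"
  using assms by (intro poly_eqI) (simp add: coeff_vec_to_poly)

lemma linear_codeD:
  assumes "linear_code n (C :: 'a vec set)"
  shows "C \<subseteq> carrier_vec n" "0\<^sub>v n \<in> C" "\<And>a b. a \<in> C \<Longrightarrow> b \<in> C \<Longrightarrow> a + b \<in> C"
    "\<And>c a. a \<in> C \<Longrightarrow> c \<cdot>\<^sub>v a \<in> C"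
  using assms unfolding linear_code_def VectorSpace.subspace_def submodule_def
  by (auto simp: module_vec_simps)

text \<open>
  When \<open>\<theta> ^^ n = id\<close>, this set is the preimage of \<open>\<C>(X)\<close> in the skew polynomial ring. Closure
  under left multiplication needs to be checked for scalars and for \<open>X\<close> only, because these
  generate the ring.
\<close>

lemma left_ideal_code_preimage:
  assumes C: "linear_code n C" and cyclic: "skew_cyclic \<theta> n C"
  shows "left_ideal {p. \<exists>a\<in>C. (monom 1 n - 1) dvd (p - vec_to_poly n a)} (skew_poly_ring \<theta>)"
    (is "left_ideal ?L _")
proof -
  note C = linear_codeD[OF C]
  have zero: "0 \<in> ?L" using C(2) by (auto intro!: bexI[of _ "0\<^sub>v n"] simp: vec_to_poly_zero)
  have add: "p + q \<in> ?L" if "p \<in> ?L" "q \<in> ?L" for p q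
  proof -
    from that obtain a b where ab: "a \<in> C" "b \<in> C"
      "(monom 1 n - 1) dvd (p - vec_to_poly n a)" "(monom 1 n - 1) dvd (q - vec_to_poly n b)"
      by auto
    have "(monom 1 n - 1) dvd (p + q - vec_to_poly n (a + b))"
      using dvd_add[OF ab(3,4)] ab(2) C(1) by (subst vec_to_poly_add) (auto simp: algebra_simps)
    then show ?thesis using C(3) ab(1,2) by blast
  qed
  have scalar: "Polynomial.smult c p \<in> ?L" if "p \<in> ?L" for c p
  proof -
    from that obtain a where a: "a \<in> C" "(monom 1 n - 1) dvd (p - vec_to_poly n a)" by auto
    have "(monom 1 n - 1) dvd (Polynomial.smult c p - vec_to_poly n (c \<cdot>\<^sub>v a))"
      using dvd_smult[OF a(2), of c] a(1) C(1)
      by (subst vec_to_poly_smult) (auto simp: smult_diff_right)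
    then show ?thesis using C(4) a(1) by blast
  qed
  have X: "skew_mult \<theta> (monom 1 1) p \<in> ?L" if "p \<in> ?L" for p
  proof -
    from that obtain a u where a: "a \<in> C" "p - vec_to_poly n a = u * (monom 1 n - 1)"
      by (auto simp: dvd_def mult.commute)
    have "skew_mult \<theta> (monom 1 1) p - skew_mult \<theta> (monom 1 1) (vec_to_poly n a)
        = skew_mult \<theta> (monom 1 1) u * (monom 1 n - 1)"
      using a(2) by (simp flip: skew_mult_diff_right skew_mult_modulus_right
          add: skew_mult_assoc[OF hom])
    then have "skew_mult \<theta> (monom 1 1) p - vec_to_poly n (skew_shift \<theta> n a)
        = (skew_mult \<theta> (monom 1 1) u + [:\<theta> (a $ (n - 1)):]) * (monom 1 n - 1)"
      unfolding X_skew_mult_vec_to_poly by (simp add: algebra_simps)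
    then have "(monom 1 n - 1) dvd (skew_mult \<theta> (monom 1 1) p - vec_to_poly n (skew_shift \<theta> n a))"
      by simp
    then show ?thesis using cyclic a(1) by (auto simp: skew_cyclic_def)
  qed
  have monom: "skew_mult \<theta> (monom c i) p \<in> ?L" if "p \<in> ?L" for c i p
    using that
  proof (induction i arbitrary: p)
    case 0
    have "skew_mult \<theta> (monom c 0) p = Polynomial.smult c p"
      unfolding skew_mult_monom_left by (simp add: map_poly_idI monom_0)
    with scalar[OF 0] show ?case by simp
  next
    case (Suc i)
    have "monom c (Suc i) = skew_mult \<theta> (monom c i) (monom 1 1)" by (simp add: skew_simps)
    with Suc.IH[OF X[OF Suc.prems]] show ?case by (simp add: skew_mult_assoc[OF hom])
  qed
  have "skew_mult \<theta> x p \<in> ?L" if p: "p \<in> ?L" for x p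
  proof (induction x rule: poly_additive_induct[OF hom])
    case 1
    show ?case using zero by (simp add: skew_simps)
  next
    case (2 x y)
    then show ?case unfolding skew_mult_add_left[OF hom] by (rule add)
  next
    case (3 c i)
    show ?case using p by (rule monom)
  qed
  with zero add show ?thesis
    by (intro left_idealI ring_skew_poly_ring[OF hom]) (simp_all add: skew_poly_ring_simps)
qed

lemma skew_poly_rep_principal:
  assumes pow: "\<theta> ^^ n = id" and C: "linear_code n C" and cyclic: "skew_cyclic \<theta> n C"
  shows "principal_left_ideal (skew_poly_rep \<theta> n C) (skew_quotient \<theta> n)"
proof -
  let ?L = "{p. \<exists>a\<in>C. (monom 1 n - 1) dvd (p - vec_to_poly n a)}"
  have "principal_left_ideal ((\<lambda>p. skew_modulus \<theta> n +>\<^bsub>skew_poly_ring \<theta>\<^esub> p) ` ?L) (skew_quotient \<theta> n)"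
    using skew_class_hom skew_class_surj
      left_ideal_skew_poly_principal[OF left_ideal_code_preimage[OF C cyclic]]
    by (rule principal_left_ideal_image)
  also have "(\<lambda>p. skew_modulus \<theta> n +>\<^bsub>skew_poly_ring \<theta>\<^esub> p) ` ?L = skew_poly_rep \<theta> n C"
    unfolding skew_poly_rep_def
  proof (intro subset_antisym image_subsetI)
    fix p assume "p \<in> ?L"
    then show "skew_modulus \<theta> n +>\<^bsub>skew_poly_ring \<theta>\<^esub> p
        \<in> (\<lambda>a. skew_modulus \<theta> n +>\<^bsub>skew_poly_ring \<theta>\<^esub> vec_to_poly n a) ` C"
      by (auto simp: skew_class_eq_iff[OF pow] image_iff)
  next
    fix a assume "a \<in> C"
    then show "skew_modulus \<theta> n +>\<^bsub>skew_poly_ring \<theta>\<^esub> vec_to_poly n a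
        \<in> (\<lambda>p. skew_modulus \<theta> n +>\<^bsub>skew_poly_ring \<theta>\<^esub> p) ` ?L"
      by (intro imageI CollectI bexI[of _ a]) auto
  qed
  finally show ?thesis .
qed

lemma skew_poly_rep_left_ideal_imp_cyclic:
  assumes pow: "\<theta> ^^ n = id" and C: "linear_code n C"
    and ideal: "left_ideal (skew_poly_rep \<theta> n C) (skew_quotient \<theta> n)"
  shows "skew_cyclic \<theta> n C"
  unfolding skew_cyclic_def
proof
  fix a assume a: "a \<in> C"
  note C = linear_codeD[OF C]
  let ?cl = "\<lambda>p. skew_modulus \<theta> n +>\<^bsub>skew_poly_ring \<theta>\<^esub> p"
  note h = ring_hom_ring.homh[OF skew_class_hom]
  have "?cl (monom 1 1) \<otimes>\<^bsub>skew_quotient \<theta> n\<^esub> ?cl (vec_to_poly n a) \<in> skew_poly_rep \<theta> n C"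
  proof (rule left_ideal.I_l_closed[OF ideal])
    show "?cl (vec_to_poly n a) \<in> skew_poly_rep \<theta> n C"
      unfolding skew_poly_rep_def using a by (rule imageI)
    show "?cl (monom 1 1) \<in> carrier (skew_quotient \<theta> n)"
      by (rule ring_hom_closed[OF h]) (simp add: skew_poly_ring_simps)
  qed
  then have "?cl (skew_mult \<theta> (monom 1 1) (vec_to_poly n a)) \<in> skew_poly_rep \<theta> n C"
    using ring_hom_mult[OF h, of "monom 1 1" "vec_to_poly n a"]
    unfolding skew_poly_ring_simps by (simp only: UNIV_I simp_thms)
  then obtain b where b: "b \<in> C" and
    dvd: "(monom 1 n - 1) dvd (skew_mult \<theta> (monom 1 1) (vec_to_poly n a) - vec_to_poly n b)"
    by (auto simp: skew_poly_rep_def skew_class_eq_iff[OF pow])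
  have "(monom 1 n - 1) dvd (vec_to_poly n (skew_shift \<theta> n a) - vec_to_poly n b)"
    using dvd_diff[OF dvd dvd_smult[OF dvd_refl, of _ "\<theta> (a $ (n - 1))"]]
    unfolding X_skew_mult_vec_to_poly by (simp add: algebra_simps)
  then have "vec_to_poly n (skew_shift \<theta> n a) - vec_to_poly n b = 0"
    by (rule modulus_dvd_imp_eq_0) (simp add: coeff_vec_to_poly)
  then have "skew_shift \<theta> n a = b"
    using b C(1) by (intro vec_to_poly_inj) (auto simp: skew_shift_def)
  with b show "skew_shift \<theta> n a \<in> C" by simp
qed

end


section \<open>The characterisation of skew cyclic codes\<close>

lemma funpow_eq_id_if_order_dvd:
  assumes bij: "bij f" and dvd: "card (generate (BijGroup UNIV) {f}) dvd n"
  shows "f ^^ n = id"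
proof -
  interpret group "BijGroup (UNIV :: 'a set)" by (rule group_BijGroup)
  have Bij: "Bij (UNIV :: 'a set) = {f. bij f}" by (simp add: Bij_def)
  have f: "f \<in> carrier (BijGroup UNIV)" using bij by (simp add: BijGroup_def Bij)
  have pow: "f [^]\<^bsub>BijGroup UNIV\<^esub> k = f ^^ k" for k :: nat
  proof (induction k)
    case 0
    show ?case by (simp add: BijGroup_def id_def)
  next
    case (Suc k)
    have "bij (f ^^ k)" using bij by (rule bij_fn)
    with Suc bij show ?case
      by (simp add: BijGroup_def Bij compose_def comp_def funpow_Suc_right del: funpow.simps)
  qed
  have "f [^]\<^bsub>BijGroup UNIV\<^esub> n = \<one>\<^bsub>BijGroup UNIV\<^esub>"
    using pow_eq_id[OF f] generate_pow_card[OF f] dvd by simp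
  then show ?thesis unfolding pow by (simp add: BijGroup_def fun_eq_iff)
qed

theorem theorem1:
  fixes \<theta> :: "'a::{field,finite} \<Rightarrow> 'a" and n :: nat and C :: "'a vec set"
  assumes "\<theta> \<in> ring_iso class_ring class_ring"
    and "linear_code n C"
    and "card (generate (BijGroup UNIV) {\<theta>}) dvd n"
  shows "skew_cyclic \<theta> n C \<longleftrightarrow>
         principal_left_ideal (skew_poly_rep \<theta> n C) (skew_quotient \<theta> n)"
proof -
  have hom: "\<theta> \<in> Ring.ring_hom class_ring class_ring" and "bij \<theta>"
    using assms(1) by (auto simp: ring_iso_def)
  then have pow: "\<theta> ^^ n = id" using assms(3) by (intro funpow_eq_id_if_order_dvd)
  show ?thesis
    using skew_poly_rep_principal[OF hom pow assms(2)]
      skew_poly_rep_left_ideal_imp_cyclic[OF hom pow assms(2)]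
    by (auto dest: principal_left_ideal.axioms)
qed

end
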